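(* Let $m>2$ be a real number and let $G$ be an admissible kernel. For each $L>0$ there exist $\nu>0$ and $\rho\in\mathcal D$ such that $$\nu\,\rho(x)^{m-1}=\mathcal G_L[\rho](x)\qquad\text{for all }x\in[0,L].$$
   Context: A kernel $G:\mathbb R\to\mathbb R$ is called admissible if: (1) $G\ge 0$ and $\mathrm{supp}(G)=\mathbb R$; (2) $G\in W^{1,1}(\mathbb R)\cap C^2(\mathbb R\setminus\{0\})$ (in particular $G$ is taken to be continuous and bounded on $\mathbb R$); (3) $G(x)=g(|x|)$ for all $x\in\mathbb R$; (4) $g'(r)<0$ for all $r>0$ and $\lim_{r\to+\infty}g(r)=0$. For $L>0$ and $\rho\in C([0,L])$ define $$\mathcal G_L[\rho](x)=\int_0^L\big[G(x-y)+G(x+y)-G(L-y)-G(L+y)\big]\rho(y)\,dy,\qquad x\in[0,L].$$ Define $$\mathcal D=\{\rho\in C([0,L]) : \rho \text{ nonnegative and nonincreasing},\ \rho(0)=1,\ \rho(L)=0\}.$$ *)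

theory Defs
  imports "HOL-Analysis.Analysis"
begin

definition function_support :: "(real \<Rightarrow> real) \<Rightarrow> real set" where
  "function_support f = closure {x. f x \<noteq> 0}"

text \<open>Meant for open \<open>S\<close>, where iterating the pointwise derivative is well behaved.\<close>

definition Ck_on :: "nat \<Rightarrow> real set \<Rightarrow> (real \<Rightarrow> real) \<Rightarrow> bool" where
  "Ck_on k S f \<longleftrightarrow>
     (\<forall>j<k. \<forall>x\<in>S. (deriv ^^ j) f field_differentiable (at x)) \<and>
     continuous_on S ((deriv ^^ k) f)"

definition test_function :: "(real \<Rightarrow> real) \<Rightarrow> bool" where
  "test_function \<phi> \<longleftrightarrow> (\<forall>k. Ck_on k UNIV \<phi>) \<and> compact (function_support \<phi>)"

definition weak_derivative :: "(real \<Rightarrow> real) \<Rightarrow> (real \<Rightarrow> real) \<Rightarrow> bool" where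
  "weak_derivative f h \<longleftrightarrow>
     (\<forall>\<phi>. test_function \<phi> \<longrightarrow>
        (LINT x|lebesgue. f x * deriv \<phi> x) = - (LINT x|lebesgue. h x * \<phi> x))"

definition W11 :: "(real \<Rightarrow> real) set" where
  "W11 = {f. integrable lebesgue f \<and> (\<exists>h. integrable lebesgue h \<and> weak_derivative f h)}"

text \<open>
  The radial profile \<open>g\<close> only matters on \<open>[0, \<infinity>)\<close>, where it agrees with \<open>G\<close>.
  Continuity and boundedness of \<open>G\<close> itself are required explicitly, since membership in
  \<open>W11\<close> only provides a continuous bounded representative almost everywhere.
\<close>

definition admissible_kernel :: "(real \<Rightarrow> real) \<Rightarrow> bool" where
  "admissible_kernel G \<longleftrightarrow>
     (\<forall>x. G x \<ge> 0) \<and> function_support G = UNIV \<and>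
     G \<in> W11 \<and> Ck_on 2 (- {0}) G \<and> continuous_on UNIV G \<and> bounded (range G) \<and>
     (\<exists>g. (\<forall>x. G x = g \<bar>x\<bar>) \<and>
          (\<forall>r>0. \<exists>D<0. (g has_real_derivative D) (at r)) \<and>
          (g \<longlongrightarrow> 0) at_top)"

definition kernel_op :: "(real \<Rightarrow> real) \<Rightarrow> real \<Rightarrow> (real \<Rightarrow> real) \<Rightarrow> real \<Rightarrow> real" where
  "kernel_op G L \<rho> x =
     integral {0..L} (\<lambda>y. (G (x - y) + G (x + y) - G (L - y) - G (L + y)) * \<rho> y)"

text \<open>Elements of \<open>C([0,L])\<close> are total functions whose values outside \<open>[0,L]\<close> are irrelevant.\<close>

definition profile_set :: "real \<Rightarrow> (real \<Rightarrow> real) set" where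
  "profile_set L =
     {\<rho>. continuous_on {0..L} \<rho> \<and> (\<forall>x\<in>{0..L}. \<rho> x \<ge> 0) \<and>
         antimono_on {0..L} \<rho> \<and> \<rho> 0 = 1 \<and> \<rho> L = 0}"

end

theory Submission
  imports Defs "HOL-Complex_Analysis.Great_Picard"
begin

text \<open>
  A solution is a fixed point \<open>\<rho> = (\<G>[\<rho>] / \<G>[\<rho>](0))\<^sup>p\<close> with \<open>p = 1 / (m - 1)\<close>. By the second mean
  value theorem, integrating a function against a nonnegative nonincreasing \<open>\<rho>\<close> gives a nonnegative
  result as soon as all its integrals over \<open>[0,a]\<close> are nonnegative, so it suffices to understand
  \<open>\<G>\<close> on indicators of \<open>[0,a]\<close>. This shows that \<open>\<G>[\<rho>]\<close> is nonincreasing and that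
  \<open>\<G>[\<rho>](0) \<ge> c \<integral>\<rho>\<close>, hence that the normalized map has an equicontinuous range. Schauder's argument
  is carried out by hand: the map restricted to step functions on a grid has an approximate fixed
  point by Kuhn's combinatorial lemma (this form of Brouwer's theorem allows the dimension to vary),
  and the Arzela-Ascoli theorem lets the mesh tend to zero.
\<close>

section \<open>Approximate fixed points in the unit cube\<close>

text \<open>Label a grid point by whether \<open>f\<close> moves its \<open>i\<close>-th coordinate
  up or down. Kuhn's lemma yields a cell in which every coordinate receives both labels, so by
  uniform continuity \<open>f x i - x i\<close> is small there for all \<open>i\<close>. Points are
  functions on \<open>nat\<close> of which only the first \<open>n\<close> values count, so that
  \<open>n\<close> is an ordinary variable.\<close>

lemma approximate_fixpoint_cube:
  fixes f :: "(nat \<Rightarrow> real) \<Rightarrow> nat \<Rightarrow> real" and n :: nat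
  assumes range: "\<And>x i. \<lbrakk>\<And>j. j < n \<Longrightarrow> x j \<in> {0..1}; i < n\<rbrakk> \<Longrightarrow> f x i \<in> {0..1}"
    and ucont: "\<And>e. 0 < e \<Longrightarrow> \<exists>d>0. \<forall>x y. (\<forall>j<n. x j \<in> {0..1} \<and> y j \<in> {0..1} \<and> \<bar>x j - y j\<bar> \<le> d)
                  \<longrightarrow> (\<forall>i<n. \<bar>f x i - f y i\<bar> \<le> e)"
    and "0 < e"
  obtains x where "\<And>j. j < n \<Longrightarrow> x j \<in> {0..1}" "\<And>i. i < n \<Longrightarrow> \<bar>f x i - x i\<bar> \<le> e"
proof -
  obtain d where "0 < d" and d: "\<forall>x y. (\<forall>j<n. x j \<in> {0..1} \<and> y j \<in> {0..1} \<and> \<bar>x j - y j\<bar> \<le> d)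
                  \<longrightarrow> (\<forall>i<n. \<bar>f x i - f y i\<bar> \<le> e / 2)"
    using ucont[of "e / 2"] \<open>0 < e\<close> half_gt_zero by blast
  obtain k :: nat where k: "inverse (real (Suc k)) < min d (e / 2)"
    using reals_Archimedean[of "min d (e / 2)"] \<open>0 < d\<close> \<open>0 < e\<close> by auto
  define p where "p = Suc k"
  have "0 < p" and pd: "1 / real p \<le> d" and pe: "1 / real p \<le> e / 2"
    using k by (auto simp: p_def field_simps)
  define pt where "pt = (\<lambda>q (j::nat). real (q j) / real p)"
  \<comment> \<open>The test \<open>pt q i \<noteq> 1\<close> forces label 1 on the face where the
    coordinate is 1, even at points whose coordinate \<open>f\<close> fixes there; Kuhn's lemma
    demands this.\<close>
  define label where "label = (\<lambda>q i. if pt q i \<noteq> 1 \<and> pt q i \<le> f (pt q) i then 0 else 1 :: nat)"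
  have pt: "pt q j \<in> {0..1}" if "q j \<le> p" for q j
    using that \<open>0 < p\<close> by (simp add: pt_def)
  have up: "f (pt q) i \<le> pt q i" if "\<forall>j<n. q j \<le> p" "i < n" "label q i = 1" for q i
    using range[of "pt q" i] pt[of q] that by (auto simp: label_def split: if_splits)
  have down: "pt q i \<le> f (pt q) i" if "label q i = 0" for q i
    using that by (auto simp: label_def split: if_splits)
  obtain q where q: "\<forall>i<n. q i < p"
    and rs: "\<forall>i<n. \<exists>r s. (\<forall>j<n. q j \<le> r j \<and> r j \<le> q j + 1) \<and>
                          (\<forall>j<n. q j \<le> s j \<and> s j \<le> q j + 1) \<and> label r i \<noteq> label s i"
  proof (rule kuhn_lemma[OF \<open>0 < p\<close>, of n label])
    show "\<forall>x. (\<forall>i<n. x i \<le> p) \<longrightarrow> (\<forall>i<n. label x i = 0 \<or> label x i = 1)"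
      by (simp add: label_def)
    show "\<forall>x. (\<forall>i<n. x i \<le> p) \<longrightarrow> (\<forall>i<n. x i = 0 \<longrightarrow> label x i = 0)"
    proof (intro allI impI)
      fix x i assume *: "\<forall>i<n. x i \<le> p" "i < n" "x i = (0::nat)"
      have "pt x j \<in> {0..1}" if "j < n" for j using pt * that by blast
      then have "f (pt x) i \<in> {0..1}" using range * by blast
      then show "label x i = 0" using * \<open>0 < p\<close> by (simp add: label_def pt_def)
    qed
    show "\<forall>x. (\<forall>i<n. x i \<le> p) \<longrightarrow> (\<forall>i<n. x i = p \<longrightarrow> label x i = 1)"
      using \<open>0 < p\<close> by (auto simp: label_def pt_def)
  qed
  have near: "\<bar>f (pt q) i - f (pt r) i\<bar> \<le> e / 2" "pt q i \<le> pt r i" "pt r i \<le> pt q i + e / 2" "\<forall>j<n. r j \<le> p"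
    if r: "\<forall>j<n. q j \<le> r j \<and> r j \<le> q j + 1" and "i < n" for r i
  proof -
    show le: "\<forall>j<n. r j \<le> p" using r q
      by fastforce
    have b: "pt q j \<le> pt r j" "pt r j \<le> pt q j + 1 / real p" if "j < n" for j
      using r that \<open>0 < p\<close> by (auto simp: pt_def divide_simps)
    show "pt q i \<le> pt r i" "pt r i \<le> pt q i + e / 2" using b[OF \<open>i < n\<close>] pe by auto
    show "\<bar>f (pt q) i - f (pt r) i\<bar> \<le> e / 2"
    proof (rule d[rule_format])
      fix j assume "j < n"
      moreover have "pt q j \<in> {0..1}" "pt r j \<in> {0..1}"
        using pt[of q j] pt[of r j] \<open>j < n\<close> q le by (auto simp: less_imp_le)
      ultimately show "pt q j \<in> {0..1} \<and> pt r j \<in> {0..1} \<and> \<bar>pt q j - pt r j\<bar> \<le> d"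
        using b[of j] pd by auto
    qed fact
  qed
  show thesis
  proof
    show "pt q j \<in> {0..1}" if "j < n" for j using pt[of q j] q that by (simp add: less_imp_le)
    fix i assume "i < n"
    then obtain r s where r: "\<forall>j<n. q j \<le> r j \<and> r j \<le> q j + 1"
      and s: "\<forall>j<n. q j \<le> s j \<and> s j \<le> q j + 1" and "label r i = 0" "label s i = 1"
    proof -
      obtain r s where *: "\<forall>j<n. q j \<le> r j \<and> r j \<le> q j + 1"
        "\<forall>j<n. q j \<le> s j \<and> s j \<le> q j + 1" "label r i \<noteq> label s i"
        using rs \<open>i < n\<close> by blast
      then consider "label r i = 0" "label s i = 1" | "label s i = 0" "label r i = 1"
        by (auto simp: label_def split: if_splits)
      then show thesis using that * by cases blast+
    qed
    \<comment> \<open>The vertex \<open>r\<close> with label 0 bounds \<open>f (pt q) i\<close> from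
      below, the vertex \<open>s\<close> with label 1 from above; the oscillation of
      \<open>f\<close> and the grid width cost at most \<open>e / 2\<close> each.\<close>
    then show "\<bar>f (pt q) i - pt q i\<bar> \<le> e"
      using near(1-3)[OF r \<open>i < n\<close>] near(1-3)[OF s \<open>i < n\<close>] down[of r i]
        up[OF near(4)[OF s \<open>i < n\<close>] \<open>i < n\<close>] by linarith
  qed
qed

section \<open>Monotone weights and elementary estimates\<close>

text \<open>The second mean value theorem turns the integral into \<open>(\<rho> 0 - \<rho> L) *
  integral {0..c} f + \<rho> L * integral {0..L} f\<close>, with nonnegative coefficients.
  Integrability comes from the same theorem, so \<open>\<rho>\<close> may be a step
  function.\<close>

lemma
  fixes f \<rho> :: "real \<Rightarrow> real"
  assumes "0 \<le> L" and f: "continuous_on {0..L} f"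
    and anti: "antimono_on {0..L} \<rho>"
  shows integrable_on_mult_antimono: "(\<lambda>y. f y * \<rho> y) integrable_on {0..L}"
    and integral_mult_antimono_nonneg:
      "\<lbrakk>\<And>y. y \<in> {0..L} \<Longrightarrow> 0 \<le> \<rho> y; \<And>a. a \<in> {0..L} \<Longrightarrow> 0 \<le> integral {0..a} f\<rbrakk>
        \<Longrightarrow> 0 \<le> integral {0..L} (\<lambda>y. f y * \<rho> y)"
proof -
  have int: "f integrable_on {0..L}"
    using f by (rule integrable_continuous_real)
  obtain c where c: "c \<in> {0..L}"
    and I: "((\<lambda>x. - \<rho> x * f x) has_integral (- \<rho> 0 * integral {0..c} f + - \<rho> L * integral {c..L} f)) {0..L}"
  \<comment> \<open>The theorem is for nondecreasing weights, hence the sign change.\<close>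
  proof (rule second_mean_value_theorem_full[OF int \<open>0 \<le> L\<close>, of "\<lambda>x. - \<rho> x"])
    show "- \<rho> x \<le> - \<rho> y" if "0 \<le> x" "x \<le> y" "y \<le> L" for x y
      using anti that by (auto simp: monotone_on_def)
  qed
  have hi: "((\<lambda>x. f x * \<rho> x) has_integral (\<rho> 0 * integral {0..c} f + \<rho> L * integral {c..L} f)) {0..L}"
    using has_integral_neg[OF I] by (simp add: algebra_simps)
  then show "(\<lambda>y. f y * \<rho> y) integrable_on {0..L}" by blast
  assume nonneg: "\<And>y. y \<in> {0..L} \<Longrightarrow> 0 \<le> \<rho> y" and F: "\<And>a. a \<in> {0..L} \<Longrightarrow> 0 \<le> integral {0..a} f"
  have split: "integral {0..c} f + integral {c..L} f = integral {0..L} f"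
    using c by (intro Henstock_Kurzweil_Integration.integral_combine int) auto
  have "\<rho> 0 * integral {0..c} f + \<rho> L * integral {c..L} f
      = (\<rho> 0 - \<rho> L) * integral {0..c} f + \<rho> L * integral {0..L} f"
    unfolding split[symmetric] by (simp add: algebra_simps)
  also have "\<dots> \<ge> 0"
    using \<open>0 \<le> L\<close> c anti by (intro add_nonneg_nonneg mult_nonneg_nonneg nonneg F)
      (auto simp: monotone_on_def)
  finally show "0 \<le> integral {0..L} (\<lambda>y. f y * \<rho> y)"
    using hi by (simp add: integral_unique)
qed

text \<open>For \<open>p < 1\<close> the power is not Lipschitz at 0, so the modulus is taken from
  compactness.\<close>

lemma powr_uniformly_continuous_unit:
  fixes p :: real
  assumes "0 < p" "0 < e"
  obtains d where "0 < d" "\<forall>s\<in>{0..1}. \<forall>t\<in>{0..1}. \<bar>s - t\<bar> < d \<longrightarrow> \<bar>s powr p - t powr p\<bar> < e"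
proof -
  have "continuous_on {0..1::real} (\<lambda>s. s powr p)"
    using assms(1) by (intro continuous_on_powr' continuous_intros) auto
  then have "uniformly_continuous_on {0..1} (\<lambda>s::real. s powr p)"
    by (rule compact_uniformly_continuous) simp
  then show thesis
    using that assms(2) unfolding uniformly_continuous_on_def dist_real_def
    by (metis abs_minus_commute)
qed

lemma quotient_close:
  fixes a b a' b' \<mu> \<eta> :: real
  assumes "0 < \<mu>" "\<mu> \<le> b" "\<mu> \<le> b'" "a' / b' \<in> {0..1}" "\<bar>a - a'\<bar> \<le> \<eta>" "\<bar>b - b'\<bar> \<le> \<eta>"
  shows "\<bar>a / b - a' / b'\<bar> \<le> 2 * \<eta> / \<mu>"
proof -
  have "0 \<le> a'"
    using assms(1,3,4) by (auto simp: zero_le_divide_iff)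
  \<comment> \<open>Only the ratio \<open>a' / b'\<close>, known to be at most 1, survives as a
    factor; the two terms then cost \<open>\<eta> / \<mu>\<close> each.\<close>
  have "a / b - a' / b' = (a - a') / b + (a' / b') * ((b' - b) / b)"
    using assms(1-3) by (simp add: field_simps)
  also have "\<bar>\<dots>\<bar> \<le> \<bar>(a - a') / b\<bar> + \<bar>(a' / b') * ((b' - b) / b)\<bar>"
    by (rule abs_triangle_ineq)
  also have "\<dots> = \<bar>a - a'\<bar> / b + \<bar>a' / b'\<bar> * (\<bar>b - b'\<bar> / b)"
    using assms(1,2) by (simp add: abs_mult abs_minus_commute)
  also have "\<dots> \<le> \<eta> / \<mu> + 1 * (\<eta> / \<mu>)"
    using assms \<open>0 \<le> a'\<close> by (intro add_mono mult_mono frac_le) auto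
  finally show ?thesis by simp
qed

lemma Min_image_close:
  fixes f g :: "'a \<Rightarrow> real"
  assumes "finite S" "S \<noteq> {}" "\<And>j. j \<in> S \<Longrightarrow> \<bar>f j - g j\<bar> \<le> e"
  shows "\<bar>Min (f ` S) - Min (g ` S)\<bar> \<le> e"
proof -
  have *: "Min (f ` S) \<le> Min (g ` S) + e" if "\<And>j. j \<in> S \<Longrightarrow> \<bar>f j - g j\<bar> \<le> e" for f g :: "'a \<Rightarrow> real"
  proof -
    have "Min (g ` S) \<in> g ` S" using assms by (intro Min_in) auto
    then obtain j where j: "j \<in> S" "Min (g ` S) = g j" by auto
    then have "Min (f ` S) \<le> f j" using assms by (intro Min_le) auto
    then show ?thesis using that[OF j(1)] j(2) by linarith
  qed
  show ?thesis using *[of f g] *[of g f] assms(3) by (fastforce simp: abs_minus_commute abs_le_iff)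
qed

section \<open>The kernel and its integrals over initial intervals\<close>

locale decreasing_kernel =
  fixes G :: "real \<Rightarrow> real" and L :: real
  assumes L_pos: "0 < L"
    and cont: "continuous_on UNIV G"
    and even: "G (- x) = G x"
    and nonneg: "0 \<le> G x"
    and decreasing: "\<lbrakk>0 \<le> r; r < s\<rbrakk> \<Longrightarrow> G s < G r"
begin

definition ker :: "real \<Rightarrow> real \<Rightarrow> real" where
  "ker x y = G (x - y) + G (x + y) - G (L - y) - G (L + y)"

definition nonneg_decreasing :: "(real \<Rightarrow> real) \<Rightarrow> bool" where
  "nonneg_decreasing \<rho> \<longleftrightarrow> antimono_on {0..L} \<rho> \<and> (\<forall>x\<in>{0..L}. 0 \<le> \<rho> x)"

lemma kernel_op_eq: "kernel_op G L \<rho> x = integral {0..L} (\<lambda>y. ker x y * \<rho> y)"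
  by (simp add: kernel_op_def ker_def)

lemma G_abs: "G \<bar>x\<bar> = G x"
  by (cases "0 \<le> x") (auto simp: even)

lemma G_less: "\<bar>r\<bar> < \<bar>s\<bar> \<Longrightarrow> G s < G r"
  using decreasing[of "\<bar>r\<bar>" "\<bar>s\<bar>"] by (simp add: G_abs)

lemma G_le_0: "G x \<le> G 0"
  using G_less[of 0 x] by (cases "x = 0") auto

lemma G_0_pos: "0 < G 0"
  using G_less[of 0 1] nonneg[of 1] by simp

lemma continuous_on_G_compose [continuous_intros]:
  "continuous_on S f \<Longrightarrow> continuous_on S (\<lambda>x. G (f x))"
  using continuous_on_compose2[OF cont] by blast

lemma continuous_on_ker: "continuous_on S (ker x)"
  unfolding ker_def by (intro continuous_intros)

lemma ker_bound: "\<bar>ker x y\<bar> \<le> 2 * G 0"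
  using nonneg[of "x - y"] nonneg[of "x + y"] nonneg[of "L - y"] nonneg[of "L + y"]
    G_le_0[of "x - y"] G_le_0[of "x + y"] G_le_0[of "L - y"] G_le_0[of "L + y"]
  unfolding ker_def by linarith

text \<open>The base point lies strictly to the left of every \<open>z\<close> with
  \<open>\<bar>z\<bar> \<le> 2 * L\<close>, so the derivative at these points is two-sided.\<close>

definition prim :: "real \<Rightarrow> real" where
  "prim z = integral {-3 * L..z} G"

lemma prim_deriv:
  assumes "\<bar>z\<bar> \<le> 2 * L"
  shows "(prim has_real_derivative G z) (at z)"
proof -
  have "(prim has_real_derivative G z) (at z within {-3 * L..3 * L})"
    unfolding prim_def using assms L_pos
    by (intro integral_has_real_derivative continuous_on_subset[OF cont]) auto
  moreover have "at z within {-3 * L..3 * L} = at z"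
    using assms L_pos by (intro at_within_interior) (auto simp: abs_if split: if_splits)
  ultimately show ?thesis by simp
qed

text \<open>For \<open>x\<close> and \<open>a\<close> in \<open>{0..L}\<close> this is the integral
  of \<open>G\<close> over \<open>[x - a, x + a]\<close>, the convolution of \<open>G\<close> with
  the indicator of \<open>[-a, a]\<close>. The form with \<open>prim\<close> gives both partial
  derivatives by the chain rule.\<close>

definition window :: "real \<Rightarrow> real \<Rightarrow> real" where
  "window x a = prim (x + a) - prim (x - a)"

lemma window_deriv:
  assumes "x \<in> {0..L}" "a \<in> {0..L}"
  shows "((\<lambda>x. window x a) has_real_derivative G (x + a) - G (x - a)) (at x)"
    and "((\<lambda>a. window x a) has_real_derivative G (x - a) + G (x + a)) (at a)"
  unfolding window_def using assms
  by (auto intro!: derivative_eq_intros DERIV_chain2[OF prim_deriv])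

text \<open>Moving the window away from the origin loses mass: the derivative
  \<open>G (x + a) - G (x - a)\<close> is negative for \<open>x > 0\<close>, since then
  \<open>\<bar>x - a\<bar> < x + a\<close>. At \<open>x = 0\<close> it vanishes, hence the mean
  value argument on the open interval.\<close>

lemma window_less:
  assumes "x \<in> {0..L}" "x' \<in> {0..L}" "x < x'" "a \<in> {0<..L}"
  shows "window x' a < window x a"
proof (rule DERIV_neg_imp_decreasing_open[OF \<open>x < x'\<close>])
  show "\<exists>y. ((\<lambda>x. window x a) has_real_derivative y) (at z) \<and> y < 0" if "x < z" "z < x'" for z
  proof (intro exI conjI)
    show "((\<lambda>x. window x a) has_real_derivative G (z + a) - G (z - a)) (at z)"
      using that assms by (intro window_deriv) auto
    show "G (z + a) - G (z - a) < 0"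
      using G_less[of "z - a" "z + a"] that assms by auto
  qed
  show "continuous_on {x..x'} (\<lambda>x. window x a)"
  proof (rule DERIV_continuous_on)
    show "((\<lambda>x. window x a) has_real_derivative G (z + a) - G (z - a)) (at z within {x..x'})"
      if "z \<in> {x..x'}" for z
      using that assms by (intro has_field_derivative_at_within[OF window_deriv(1)]) auto
  qed
qed

lemma integral_ker:
  assumes "x \<in> {0..L}" "a \<in> {0..L}"
  shows "integral {0..a} (ker x) = window x a - window L a"
proof -
  have "(ker x has_integral ((window x a - window L a) - (window x 0 - window L 0))) {0..a}"
  proof (rule fundamental_theorem_of_calculus)
    show "0 \<le> a" using assms by simp
    fix y assume y: "y \<in> {0..a}"
    have "((\<lambda>y. window x y - window L y) has_real_derivative
        (G (x - y) + G (x + y)) - (G (L - y) + G (L + y))) (at y)"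
      using assms y L_pos by (intro DERIV_diff window_deriv) auto
    then show "((\<lambda>y. window x y - window L y) has_vector_derivative ker x y) (at y within {0..a})"
      by (auto simp: ker_def algebra_simps has_real_derivative_iff_has_vector_derivative
          intro: has_vector_derivative_at_within)
  qed
  then show ?thesis by (simp add: window_def integral_unique)
qed

lemma integral_ker_antimono:
  assumes "x \<in> {0..L}" "x' \<in> {0..L}" "x \<le> x'" "a \<in> {0..L}"
  shows "integral {0..a} (ker x') \<le> integral {0..a} (ker x)"
proof (cases "x = x' \<or> a = 0")
  case False
  then show ?thesis
    using window_less[of x x' a] assms by (simp add: integral_ker)
qed auto

text \<open>\<open>ker 0\<close> can be negative near \<open>L\<close>, so only its integrals are
  bounded. For small \<open>a\<close> the integrand exceeds half of \<open>ker 0 0 > 0\<close>; on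
  the remaining compact range the integral is continuous and positive.\<close>

lemma integral_ker_0_lower:
  obtains c where "0 < c" "\<forall>a\<in>{0..L}. c * a \<le> integral {0..a} (ker 0)"
proof -
  let ?\<psi> = "\<lambda>a. integral {0..a} (ker 0)"
  have "0 < ker 0 0"
    using G_less[of 0 L] L_pos by (simp add: ker_def)
  moreover have "isCont (ker 0) 0"
    using continuous_on_ker[of UNIV 0] by (simp add: continuous_on_eq_continuous_at)
  ultimately obtain \<eta> where "0 < \<eta>" and \<eta>: "\<And>y. \<bar>y\<bar> < \<eta> \<Longrightarrow> ker 0 0 / 2 < ker 0 y"
    using continuous_at_eps_delta[THEN iffD1, rule_format, of 0 "ker 0" "ker 0 0 / 2"]
    by (auto simp: dist_real_def) (smt (verit, best) field_sum_of_halves)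
  define b where "b = min (\<eta> / 2) L"
  have b: "0 < b" "b \<le> L" "b < \<eta>" using \<open>0 < \<eta>\<close> L_pos by (auto simp: b_def)
  have "continuous_on {b..L} ?\<psi>"
    by (rule continuous_on_subset[OF indefinite_integral_continuous_1[OF
          integrable_continuous_real[OF continuous_on_ker]]]) (use b in auto)
  then obtain a0 where a0: "a0 \<in> {b..L}" "\<And>a. a \<in> {b..L} \<Longrightarrow> ?\<psi> a0 \<le> ?\<psi> a"
    using continuous_attains_inf[of "{b..L}" ?\<psi>] b by fastforce
  have "0 < ?\<psi> a0"
    using a0(1) b L_pos window_less[of 0 L a0] by (simp add: integral_ker)
  \<comment> \<open>The first entry serves \<open>a \<le> b\<close>, the second serves
    \<open>a > b\<close> by way of \<open>c * a \<le> c * L\<close>.\<close>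
  define c where "c = min (ker 0 0 / 2) (?\<psi> a0 / L)"
  show thesis
  proof
    show "0 < c" using \<open>0 < ker 0 0\<close> \<open>0 < ?\<psi> a0\<close> L_pos by (simp add: c_def)
    show "\<forall>a\<in>{0..L}. c * a \<le> ?\<psi> a"
    proof
      fix a assume a: "a \<in> {0..L}"
      show "c * a \<le> ?\<psi> a"
      proof (cases "a \<le> b")
        case True
        have "integral {0..a} (\<lambda>_. c) \<le> ?\<psi> a"
        proof (rule integral_le)
          show "c \<le> ker 0 y" if "y \<in> {0..a}" for y
            using \<eta>[of y] that True b by (simp add: c_def)
        qed (auto intro: integrable_continuous_real continuous_on_ker)
        then show ?thesis using a by (simp add: mult.commute)
      next
        case False
        have "c * a \<le> (?\<psi> a0 / L) * L"
          using a \<open>0 < ?\<psi> a0\<close> L_pos by (intro mult_mono) (auto simp: c_def)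
        also have "\<dots> \<le> ?\<psi> a" using a0(2)[of a] a False L_pos by simp
        finally show ?thesis .
      qed
    qed
  qed
qed

section \<open>The operator on nonnegative nonincreasing functions\<close>

context
  fixes \<rho> assumes \<rho>: "nonneg_decreasing \<rho>"
begin

lemma integrable_mult: "continuous_on {0..L} f \<Longrightarrow> (\<lambda>y. f y * \<rho> y) integrable_on {0..L}"
  using \<rho> L_pos by (intro integrable_on_mult_antimono) (auto simp: nonneg_decreasing_def)

lemma integral_mult_nonneg:
  "\<lbrakk>continuous_on {0..L} f; \<And>a. a \<in> {0..L} \<Longrightarrow> 0 \<le> integral {0..a} f\<rbrakk>
    \<Longrightarrow> 0 \<le> integral {0..L} (\<lambda>y. f y * \<rho> y)"
  using \<rho> L_pos by (intro integral_mult_antimono_nonneg) (auto simp: nonneg_decreasing_def)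

lemma integrable_profile: "\<rho> integrable_on {0..L}"
  using integrable_mult[of "\<lambda>_. 1"] by simp

lemma integrable_ker: "(\<lambda>y. ker x y * \<rho> y) integrable_on {0..L}"
  by (intro integrable_mult continuous_on_ker)

text \<open>The difference \<open>ker x y - ker x' y\<close> need not have a sign, but its integrals
  over \<open>[0,a]\<close> are nonnegative, which suffices against a nonincreasing weight.\<close>

lemma kernel_op_antimono:
  assumes "x \<in> {0..L}" "x' \<in> {0..L}" "x \<le> x'"
  shows "kernel_op G L \<rho> x' \<le> kernel_op G L \<rho> x"
proof -
  have "0 \<le> integral {0..L} (\<lambda>y. (ker x y - ker x' y) * \<rho> y)"
  proof (rule integral_mult_nonneg)
    show "0 \<le> integral {0..a} (\<lambda>y. ker x y - ker x' y)" if "a \<in> {0..L}" for a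
      using integral_ker_antimono[OF assms that]
      by (subst Henstock_Kurzweil_Integration.integral_diff)
        (auto intro!: integrable_continuous_real continuous_on_ker)
  qed (intro continuous_intros continuous_on_ker)
  also have "\<dots> = kernel_op G L \<rho> x - kernel_op G L \<rho> x'"
    unfolding kernel_op_eq
    by (subst Henstock_Kurzweil_Integration.integral_diff[symmetric])
      (auto intro!: integrable_ker simp: left_diff_distrib)
  finally show ?thesis by simp
qed

text \<open>The kernel vanishes identically at \<open>x = L\<close>, so monotonicity gives the
  sign.\<close>

lemma kernel_op_nonneg: "x \<in> {0..L} \<Longrightarrow> 0 \<le> kernel_op G L \<rho> x"
  using kernel_op_antimono[of x L] L_pos by (simp add: kernel_op_def)

text \<open>The criterion for monotone weights is applied to \<open>ker 0 y - c\<close>.\<close>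

lemma kernel_op_0_lower:
  assumes "\<forall>a\<in>{0..L}. c * a \<le> integral {0..a} (ker 0)"
  shows "c * integral {0..L} \<rho> \<le> kernel_op G L \<rho> 0"
proof -
  have "0 \<le> integral {0..L} (\<lambda>y. (ker 0 y - c) * \<rho> y)"
  proof (rule integral_mult_nonneg)
    show "0 \<le> integral {0..a} (\<lambda>y. ker 0 y - c)" if "a \<in> {0..L}" for a
      using assms that
      by (subst Henstock_Kurzweil_Integration.integral_diff)
        (auto intro!: integrable_continuous_real continuous_on_ker simp: mult.commute)
  qed (intro continuous_intros continuous_on_ker)
  also have "\<dots> = kernel_op G L \<rho> 0 - c * integral {0..L} \<rho>"
    unfolding kernel_op_eq integral_mult_right[symmetric]
    by (subst Henstock_Kurzweil_Integration.integral_diff[symmetric])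
      (auto intro!: integrable_ker integrable_mult continuous_intros simp: left_diff_distrib)
  finally show ?thesis by simp
qed

lemma kernel_op_diff_le:
  assumes "\<And>y. y \<in> {0..L} \<Longrightarrow> \<bar>ker x y - ker x' y\<bar> \<le> e"
  shows "\<bar>kernel_op G L \<rho> x - kernel_op G L \<rho> x'\<bar> \<le> e * integral {0..L} \<rho>"
proof -
  have "kernel_op G L \<rho> x - kernel_op G L \<rho> x' = integral {0..L} (\<lambda>y. (ker x y - ker x' y) * \<rho> y)"
    unfolding kernel_op_eq
    by (subst Henstock_Kurzweil_Integration.integral_diff[symmetric])
      (auto intro!: integrable_ker simp: left_diff_distrib)
  moreover have "norm (integral {0..L} (\<lambda>y. (ker x y - ker x' y) * \<rho> y)) \<le> integral {0..L} (\<lambda>y. e * \<rho> y)"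
  proof (rule integral_norm_bound_integral)
    show "norm ((ker x y - ker x' y) * \<rho> y) \<le> e * \<rho> y" if "y \<in> {0..L}" for y
      using assms[OF that] \<rho> that by (simp add: abs_mult nonneg_decreasing_def mult_right_mono)
  qed (intro integrable_mult continuous_intros continuous_on_ker)+
  ultimately show ?thesis by simp
qed

end

lemma kernel_op_lipschitz:
  assumes "nonneg_decreasing \<rho>" "nonneg_decreasing \<sigma>"
    and close: "\<And>y. y \<in> {0..L} \<Longrightarrow> \<bar>\<rho> y - \<sigma> y\<bar> \<le> e"
  shows "\<bar>kernel_op G L \<rho> x - kernel_op G L \<sigma> x\<bar> \<le> 2 * G 0 * L * e"
proof -
  have "kernel_op G L \<rho> x - kernel_op G L \<sigma> x = integral {0..L} (\<lambda>y. ker x y * \<rho> y - ker x y * \<sigma> y)"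
    unfolding kernel_op_eq
    by (subst Henstock_Kurzweil_Integration.integral_diff) (auto intro!: integrable_ker assms)
  moreover have "norm (integral {0..L} (\<lambda>y. ker x y * \<rho> y - ker x y * \<sigma> y)) \<le> integral {0..L} (\<lambda>_. 2 * G 0 * e)"
  proof (rule integral_norm_bound_integral)
    show "norm (ker x y * \<rho> y - ker x y * \<sigma> y) \<le> 2 * G 0 * e" if "y \<in> {0..L}" for y
      using mult_mono[OF ker_bound[of x y] close[OF that]] G_0_pos
      by (simp add: abs_mult flip: right_diff_distrib)
  qed (auto intro!: integrable_ker assms integrable_diff)
  ultimately show ?thesis using L_pos by (simp add: mult_ac)
qed

lemma ker_uniformly_continuous:
  assumes "0 < e"
  obtains d where "0 < d" "\<forall>x\<in>{0..L}. \<forall>x'\<in>{0..L}. \<forall>y\<in>{0..L}. \<bar>x - x'\<bar> < d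
    \<longrightarrow> \<bar>ker x y - ker x' y\<bar> \<le> e"
proof -
  \<comment> \<open>This interval contains \<open>x - y\<close> and \<open>x + y\<close> for all
    \<open>x\<close>, \<open>y\<close> in \<open>{0..L}\<close>; the two terms with \<open>L\<close>
    cancel in the difference.\<close>
  have "uniformly_continuous_on {- L..2 * L} G"
    by (rule compact_uniformly_continuous[OF continuous_on_subset[OF cont]]) auto
  then obtain d where "0 < d" and d: "\<forall>x\<in>{- L..2 * L}. \<forall>x'\<in>{- L..2 * L}.
      \<bar>x' - x\<bar> < d \<longrightarrow> \<bar>G x' - G x\<bar> < e / 2"
    using half_gt_zero[OF assms] unfolding uniformly_continuous_on_def dist_real_def by blast
  show thesis
  proof (rule that[OF \<open>0 < d\<close>], intro ballI impI)
    fix x x' y assume *: "x \<in> {0..L}" "x' \<in> {0..L}" "y \<in> {0..L}" "\<bar>x - x'\<bar> < d"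
    show "\<bar>ker x y - ker x' y\<bar> \<le> e"
    proof -
      have "\<bar>G (x - y) - G (x' - y)\<bar> < e / 2" "\<bar>G (x + y) - G (x' + y)\<bar> < e / 2"
        using d[rule_format, of "x' - y" "x - y"] d[rule_format, of "x' + y" "x + y"] * by auto
      then show ?thesis unfolding ker_def by linarith
    qed
  qed
qed

lemma kernel_op_0_pos:
  assumes "nonneg_decreasing \<rho>" "0 < integral {0..L} \<rho>"
  shows "0 < kernel_op G L \<rho> 0"
proof -
  obtain c where "0 < c" "\<forall>a\<in>{0..L}. c * a \<le> integral {0..a} (ker 0)"
    using integral_ker_0_lower by blast
  then show ?thesis
    using kernel_op_0_lower[OF assms(1), of c] assms(2)
    by (meson less_le_trans mult_pos_pos)
qed

section \<open>The normalized map and its equicontinuity\<close>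

definition normalized_op :: "real \<Rightarrow> (real \<Rightarrow> real) \<Rightarrow> real \<Rightarrow> real" where
  "normalized_op p \<rho> x = (kernel_op G L \<rho> x / kernel_op G L \<rho> 0) powr p"

text \<open>Should the denominator be 0, the quotient is 0 by convention and still lies in the unit
  interval.\<close>

lemma kernel_op_ratio:
  assumes "nonneg_decreasing \<rho>" "x \<in> {0..L}"
  shows "kernel_op G L \<rho> x / kernel_op G L \<rho> 0 \<in> {0..1}"
  using kernel_op_nonneg[OF assms] kernel_op_antimono[OF assms(1), of 0 x] assms L_pos
  by (auto simp: divide_le_eq_1)

lemma normalized_op_range:
  assumes "0 < p" "nonneg_decreasing \<rho>" "x \<in> {0..L}"
  shows "normalized_op p \<rho> x \<in> {0..1}"
  using kernel_op_ratio[OF assms(2,3)] powr_mono2[of p _ 1] assms(1)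
  by (auto simp: normalized_op_def)

lemma normalized_op_antimono:
  assumes "0 < p" "nonneg_decreasing \<rho>" "x \<in> {0..L}" "x' \<in> {0..L}" "x \<le> x'"
  shows "normalized_op p \<rho> x' \<le> normalized_op p \<rho> x"
  unfolding normalized_op_def
  using kernel_op_ratio[OF assms(2,4)] assms L_pos
  by (intro powr_mono2 divide_right_mono kernel_op_antimono kernel_op_nonneg) auto

lemma normalized_op_L: "normalized_op p \<rho> L = 0"
  by (simp add: normalized_op_def kernel_op_def)

lemma normalized_op_0:
  "\<lbrakk>nonneg_decreasing \<rho>; 0 < integral {0..L} \<rho>\<rbrakk> \<Longrightarrow> normalized_op p \<rho> 0 = 1"
  using kernel_op_0_pos[of \<rho>] by (simp add: normalized_op_def)

text \<open>The modulus of continuity does not depend on \<open>\<rho>\<close>, however small its mass: both the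
  oscillation of the numerator and the denominator scale with \<open>\<integral>\<rho>\<close>.\<close>

lemma normalized_op_equicontinuous:
  assumes "0 < p" "0 < e"
  obtains d where "0 < d"
    "\<forall>\<rho>. nonneg_decreasing \<rho> \<and> 0 < integral {0..L} \<rho> \<longrightarrow> (\<forall>x\<in>{0..L}. \<forall>x'\<in>{0..L}. \<bar>x - x'\<bar> < d \<longrightarrow>
      \<bar>normalized_op p \<rho> x - normalized_op p \<rho> x'\<bar> < e)"
proof -
  obtain c where "0 < c" and c: "\<forall>a\<in>{0..L}. c * a \<le> integral {0..a} (ker 0)"
    using integral_ker_0_lower by blast
  obtain h where "0 < h" and h: "\<forall>s\<in>{0..1}. \<forall>t\<in>{0..1}. \<bar>s - t\<bar> < h \<longrightarrow> \<bar>s powr p - t powr p\<bar> < e"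
    using powr_uniformly_continuous_unit[OF assms] by blast
  \<comment> \<open>With this tolerance for the kernel, dividing by
    \<open>kernel_op G L \<rho> 0 \<ge> c * integral {0..L} \<rho>\<close> leaves
    \<open>h / 2\<close>.\<close>
  have "0 < c * (h / 2)" using \<open>0 < c\<close> \<open>0 < h\<close> by simp
  obtain d where "0 < d" and d: "\<forall>x\<in>{0..L}. \<forall>x'\<in>{0..L}. \<forall>y\<in>{0..L}. \<bar>x - x'\<bar> < d
    \<longrightarrow> \<bar>ker x y - ker x' y\<bar> \<le> c * (h / 2)"
    using ker_uniformly_continuous[OF \<open>0 < c * (h / 2)\<close>] by blast
  show thesis
  proof (rule that[OF \<open>0 < d\<close>], intro allI impI ballI)
    fix \<rho> x x'
    assume "nonneg_decreasing \<rho> \<and> 0 < integral {0..L} \<rho>"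
    then have \<rho>: "nonneg_decreasing \<rho>" "0 < integral {0..L} \<rho>" by auto
    assume x: "x \<in> {0..L}" "x' \<in> {0..L}" "\<bar>x - x'\<bar> < d"
    let ?A = "kernel_op G L \<rho>"
    have pos: "0 < ?A 0" using kernel_op_0_pos \<rho> by blast
    have "\<bar>?A x - ?A x'\<bar> \<le> c * (h / 2) * integral {0..L} \<rho>"
      using d x by (intro kernel_op_diff_le \<rho>) auto
    also have "\<dots> \<le> h / 2 * ?A 0"
      using mult_left_mono[OF kernel_op_0_lower[OF \<rho>(1) c], of "h / 2"] \<open>0 < h\<close> by (simp add: mult_ac)
    finally have "\<bar>?A x / ?A 0 - ?A x' / ?A 0\<bar> \<le> h / 2"
      using pos by (simp add: field_simps flip: diff_divide_distrib)
    then show "\<bar>normalized_op p \<rho> x - normalized_op p \<rho> x'\<bar> < e"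
      unfolding normalized_op_def using x \<rho> \<open>0 < h\<close> by (intro h[rule_format] kernel_op_ratio) auto
  qed
qed

section \<open>Step functions on a grid\<close>

text \<open>The running minimum makes a nonincreasing step function out of an arbitrary vector in the cube;
  the value \<open>1\<close> on the first cell bounds its mass from below for each fixed \<open>n\<close>.\<close>

definition step :: "nat \<Rightarrow> (nat \<Rightarrow> real) \<Rightarrow> real \<Rightarrow> real" where
  "step n v t = Min ((\<lambda>j. if j = 0 then 1 else v j) ` {..nat \<lfloor>t * real n / L\<rfloor>})"

text \<open>The endpoint \<open>t = L\<close> has index \<open>n\<close>, so vectors carry
  \<open>Suc n\<close> coordinates.\<close>

lemma step_index_le:
  assumes "t \<in> {0..L}"
  shows "nat \<lfloor>t * real n / L\<rfloor> \<le> n"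
proof -
  have "t * real n / L \<le> real n"
    using assms L_pos by (simp add: divide_simps mult_right_mono mult.commute[of "real n"])
  then show ?thesis by linarith
qed

lemma step_nonneg_decreasing:
  assumes "\<forall>j<Suc n. v j \<in> {0..1}"
  shows "nonneg_decreasing (step n v)"
  unfolding nonneg_decreasing_def
proof
  show "antimono_on {0..L} (step n v)"
    unfolding step_def using L_pos
    by (intro monotone_onI Min_antimono image_mono)
      (auto intro!: nat_mono floor_mono divide_right_mono mult_right_mono)
  show "\<forall>x\<in>{0..L}. 0 \<le> step n v x"
  proof
    fix x assume "x \<in> {0..L}"
    then show "0 \<le> step n v x"
      using step_index_le[of x n] assms unfolding step_def by (subst Min_ge_iff) force+
  qed
qed

lemma step_integral:
  assumes "\<forall>j<Suc n. v j \<in> {0..1}" "0 < n"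
  shows "L / (2 * real n) \<le> integral {0..L} (step n v)"
proof -
  have int: "step n v integrable_on {0..L}"
    by (intro integrable_profile step_nonneg_decreasing assms(1))
  \<comment> \<open>Half of the first cell, so that the closed interval stays clear of the possible
    jump at \<open>L / n\<close>.\<close>
  let ?b = "L / (2 * real n)"
  have b: "0 \<le> ?b" "?b \<le> L"
    using L_pos assms(2) by (auto simp: field_simps)
  have "?b = integral {0..?b} (\<lambda>_. 1)" using b by simp
  also have "\<dots> = integral {0..?b} (step n v)"
  proof (rule integral_cong)
    fix t assume "t \<in> {0..?b}"
    then have "t * real n / L \<le> 1 / 2" "0 \<le> t * real n / L"
      using L_pos assms(2) by (auto simp: field_simps)
    then have "\<lfloor>t * real n / L\<rfloor> = 0" by linarith
    then show "1 = step n v t" unfolding step_def by simp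
  qed
  also have "\<dots> \<le> integral {0..L} (step n v)"
    using step_nonneg_decreasing[OF assms(1)] b
    by (intro integral_subset_le integrable_subinterval_real[OF int] int)
      (auto simp: nonneg_decreasing_def)
  finally show ?thesis .
qed

lemma step_close:
  assumes "\<forall>j<Suc n. \<bar>v j - w j\<bar> \<le> e" "0 \<le> e" "t \<in> {0..L}"
  shows "\<bar>step n v t - step n w t\<bar> \<le> e"
  unfolding step_def using step_index_le[OF assms(3), of n] assms(1,2)
  by (intro Min_image_close) auto

text \<open>For nonincreasing samples the running minimum is the last one, and the prescribed first
  value 1 is the true one. Thus the step function takes at \<open>t\<close> the value of
  \<open>u\<close> at the left grid point \<open>s\<close> of the cell of \<open>t\<close>.\<close>

lemma step_grid:
  assumes "antimono_on {0..L} u" "u 0 = 1" "0 < n" "t \<in> {0..L}"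
  defines "s \<equiv> real (nat \<lfloor>t * real n / L\<rfloor>) * L / real n"
  shows "step n (\<lambda>i. u (real i * L / real n)) t = u s" "s \<in> {0..L}" "\<bar>t - s\<bar> < L / real n"
proof -
  let ?k = "nat \<lfloor>t * real n / L\<rfloor>"
  have k: "?k \<le> n" by (rule step_index_le[OF assms(4)])
  have grid: "real j * L / real n \<in> {0..L}" if "j \<le> n" for j
    using that L_pos assms(3) by (auto simp: field_simps)
  then show "s \<in> {0..L}" using k by (simp add: s_def)
  have eq: "(\<lambda>j. if j = 0 then 1 else u (real j * L / real n)) = (\<lambda>j. u (real j * L / real n))"
    using assms(2) by auto
  show "step n (\<lambda>i. u (real i * L / real n)) t = u s"
    unfolding step_def eq
  proof (rule Min_eqI)
    fix y assume "y \<in> (\<lambda>j. u (real j * L / real n)) ` {..?k}"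
    then obtain j where j: "j \<le> ?k" "y = u (real j * L / real n)" by auto
    then have "real j * L / real n \<le> s"
      unfolding s_def using L_pos by (intro divide_right_mono mult_right_mono) auto
    then show "u s \<le> y"
      using assms(1) grid[of j] grid[of ?k] j k by (auto simp: monotone_on_def s_def)
  qed (auto simp: s_def)
  have "0 \<le> t * real n / L" using assms L_pos by auto
  then have "\<bar>t * real n / L - real ?k\<bar> < 1" by linarith
  then have "L / real n * \<bar>t * real n / L - real ?k\<bar> < L / real n * 1"
    using L_pos assms(3) by (intro mult_strict_left_mono) auto
  also have "L / real n * \<bar>t * real n / L - real ?k\<bar> = \<bar>L / real n * (t * real n / L - real ?k)\<bar>"
    using L_pos by (simp add: abs_mult)
  also have "L / real n * (t * real n / L - real ?k) = t - s"
    unfolding s_def using L_pos assms(3) by (simp add: field_simps)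
  finally show "\<bar>t - s\<bar> < L / real n" by simp
qed

section \<open>Approximate solutions\<close>

text \<open>The map sending \<open>v\<close> to the grid samples of
  \<open>normalized_op p (step n v)\<close> has an approximate fixed point. Its step function is
  close to that of the samples, which in turn is close to the sampled function by
  equicontinuity.\<close>

lemma approximate_solution:
  assumes "0 < p" "0 < e"
  obtains \<rho> where "nonneg_decreasing \<rho>" "0 < integral {0..L} \<rho>"
    "\<And>t. t \<in> {0..L} \<Longrightarrow> \<bar>\<rho> t - normalized_op p \<rho> t\<bar> \<le> e"
proof -
  obtain d where "0 < d" and d: "\<forall>\<rho>. nonneg_decreasing \<rho> \<and> 0 < integral {0..L} \<rho> \<longrightarrow>
      (\<forall>x\<in>{0..L}. \<forall>x'\<in>{0..L}. \<bar>x - x'\<bar> < d \<longrightarrow> \<bar>normalized_op p \<rho> x - normalized_op p \<rho> x'\<bar> < e / 2)"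
    using normalized_op_equicontinuous[OF \<open>0 < p\<close>, of "e / 2"] half_gt_zero[OF \<open>0 < e\<close>] by blast
  \<comment> \<open>The modulus \<open>d\<close> is uniform in \<open>\<rho>\<close>, so the mesh
    can be fixed before the vector \<open>v\<close> is known.\<close>
  obtain k :: nat where "inverse (real (Suc k)) < d / L"
    using reals_Archimedean[of "d / L"] \<open>0 < d\<close> L_pos by auto
  moreover define n where "n = Suc k"
  ultimately have "0 < n" and n: "L / real n < d"
    using L_pos by (auto simp: field_simps)
  obtain c where "0 < c" and c: "\<forall>a\<in>{0..L}. c * a \<le> integral {0..a} (ker 0)"
    using integral_ker_0_lower by blast
  \<comment> \<open>A lower bound for the denominators. It shrinks as \<open>n\<close> grows, but it
    only serves the continuity in \<open>v\<close> for this fixed \<open>n\<close>.\<close>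
  define \<mu> where "\<mu> = c * (L / (2 * real n))"
  have "0 < \<mu>" using \<open>0 < c\<close> L_pos \<open>0 < n\<close> by (simp add: \<mu>_def)
  define K where "K = 2 * G 0 * L"
  have "0 < K" using G_0_pos L_pos by (simp add: K_def)
  have mass: "0 < integral {0..L} (step n v)" "\<mu> \<le> kernel_op G L (step n v) 0"
    if "\<forall>j<Suc n. v j \<in> {0..1}" for v
  proof -
    note * = step_integral[OF that \<open>0 < n\<close>]
    show "0 < integral {0..L} (step n v)"
      using * L_pos \<open>0 < n\<close> by (intro less_le_trans[OF _ *]) simp
    have "\<mu> \<le> c * integral {0..L} (step n v)"
      unfolding \<mu>_def using * \<open>0 < c\<close> by (intro mult_left_mono) auto
    also have "\<dots> \<le> kernel_op G L (step n v) 0"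
      by (intro kernel_op_0_lower step_nonneg_decreasing that c)
    finally show "\<mu> \<le> kernel_op G L (step n v) 0" .
  qed
  have grid: "real i * L / real n \<in> {0..L}" if "i < Suc n" for i
    using that L_pos \<open>0 < n\<close> by (auto simp: field_simps)
  obtain v where v: "\<And>j. j < Suc n \<Longrightarrow> v j \<in> {0..1}"
    and fp: "\<And>i. i < Suc n \<Longrightarrow> \<bar>normalized_op p (step n v) (real i * L / real n) - v i\<bar> \<le> e / 2"
  proof (rule approximate_fixpoint_cube[of "Suc n" "\<lambda>v i. normalized_op p (step n v) (real i * L / real n)" "e / 2"])
    show "normalized_op p (step n v) (real i * L / real n) \<in> {0..1}"
      if "\<And>j. j < Suc n \<Longrightarrow> v j \<in> {0..1}" "i < Suc n" for v i
      using that by (intro normalized_op_range step_nonneg_decreasing grid \<open>0 < p\<close>) auto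
    show "\<exists>d>0. \<forall>x y. (\<forall>j<Suc n. x j \<in> {0..1} \<and> y j \<in> {0..1} \<and> \<bar>x j - y j\<bar> \<le> d)
       \<longrightarrow> (\<forall>i<Suc n. \<bar>normalized_op p (step n x) (real i * L / real n) -
              normalized_op p (step n y) (real i * L / real n)\<bar> \<le> e')" if "0 < e'" for e'
    proof -
      obtain h where "0 < h" and h: "\<forall>s\<in>{0..1}. \<forall>t\<in>{0..1}. \<bar>s - t\<bar> < h \<longrightarrow> \<bar>s powr p - t powr p\<bar> < e'"
        using powr_uniformly_continuous_unit[OF \<open>0 < p\<close> \<open>0 < e'\<close>] by blast
      \<comment> \<open>Chosen so that the quotient estimate
        \<open>2 * (K * \<delta>) / \<mu>\<close> equals \<open>h / 2\<close>.\<close>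
      define \<delta> where "\<delta> = h * \<mu> / (4 * K)"
      have "0 < \<delta>" using \<open>0 < h\<close> \<open>0 < \<mu>\<close> \<open>0 < K\<close> by (simp add: \<delta>_def)
      have "\<bar>normalized_op p (step n x) (real i * L / real n) -
              normalized_op p (step n y) (real i * L / real n)\<bar> \<le> e'"
        if xy: "\<forall>j<Suc n. x j \<in> {0..1} \<and> y j \<in> {0..1} \<and> \<bar>x j - y j\<bar> \<le> \<delta>" and i: "i < Suc n" for x y i
      proof -
        let ?A = "kernel_op G L (step n x)" and ?B = "kernel_op G L (step n y)"
        let ?t = "real i * L / real n"
        have nd: "nonneg_decreasing (step n x)" "nonneg_decreasing (step n y)"
          using xy by (auto intro!: step_nonneg_decreasing)
        have diff: "\<bar>?A z - ?B z\<bar> \<le> K * \<delta>" for z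
          unfolding K_def using xy \<open>0 < \<delta>\<close> by (intro kernel_op_lipschitz nd step_close) auto
        have "\<bar>?A ?t / ?A 0 - ?B ?t / ?B 0\<bar> \<le> 2 * (K * \<delta>) / \<mu>"
          using xy \<open>0 < \<mu>\<close> kernel_op_ratio[OF nd(2) grid[OF i]]
          by (intro quotient_close diff mass) auto
        also have "\<dots> = h / 2"
          using \<open>0 < K\<close> \<open>0 < \<mu>\<close> by (simp add: \<delta>_def)
        also have "\<dots> < h" using \<open>0 < h\<close> by simp
        finally show ?thesis
          unfolding normalized_op_def
          by (intro less_imp_le h[rule_format] kernel_op_ratio nd grid i)
      qed
      then show ?thesis using \<open>0 < \<delta>\<close> by blast
    qed
  qed (use \<open>0 < e\<close> in auto)
  let ?\<rho> = "step n v"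
  have nd: "nonneg_decreasing ?\<rho>" and pos: "0 < integral {0..L} ?\<rho>"
    using v by (auto intro!: step_nonneg_decreasing mass)
  show thesis
  proof
    fix t assume t: "t \<in> {0..L}"
    let ?u = "normalized_op p ?\<rho>"
    have u: "antimono_on {0..L} ?u" "?u 0 = 1"
      using normalized_op_antimono[OF \<open>0 < p\<close> nd] normalized_op_0[OF nd pos] by (auto simp: monotone_on_def)
    note g = step_grid[OF u \<open>0 < n\<close> t]
    have "\<bar>?\<rho> t - step n (\<lambda>i. ?u (real i * L / real n)) t\<bar> \<le> e / 2"
      using fp \<open>0 < e\<close> t by (intro step_close) (auto simp: abs_minus_commute)
    moreover have "\<bar>?u t - step n (\<lambda>i. ?u (real i * L / real n)) t\<bar> < e / 2"
      unfolding g(1) using n g(3) by (intro d[rule_format] conjI nd pos t g(2)) auto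
    ultimately show "\<bar>?\<rho> t - ?u t\<bar> \<le> e" by linarith
  qed (use nd pos in auto)
qed

section \<open>Passage to the limit\<close>

text \<open>Compactness is applied to the images \<open>u n\<close>, which are equicontinuous, and
  not to the approximate solutions \<open>\<rho> n\<close>, which may jump. Since the two differ by
  at most \<open>1 / (n + 1)\<close>, they share their limit along the subsequence.\<close>

lemma solution_exists:
  assumes "0 < p"
  obtains \<rho> where "\<rho> \<in> profile_set L" "0 < kernel_op G L \<rho> 0"
    "\<And>x. x \<in> {0..L} \<Longrightarrow> \<rho> x = normalized_op p \<rho> x"
proof -
  have "\<exists>\<rho>. nonneg_decreasing \<rho> \<and> 0 < integral {0..L} \<rho> \<and>
    (\<forall>t\<in>{0..L}. \<bar>\<rho> t - normalized_op p \<rho> t\<bar> \<le> inverse (real (Suc n)))" for n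
    by (rule approximate_solution[OF assms, of "inverse (real (Suc n))"]) auto
  then obtain \<rho> where nd: "\<And>n. nonneg_decreasing (\<rho> n)" and pos: "\<And>n. 0 < integral {0..L} (\<rho> n)"
    and close: "\<And>n t. t \<in> {0..L} \<Longrightarrow> \<bar>\<rho> n t - normalized_op p (\<rho> n) t\<bar> \<le> inverse (real (Suc n))"
    by metis
  define u where "u = (\<lambda>n. normalized_op p (\<rho> n))"
  obtain g k where "continuous_on {0..L} g" and k: "strict_mono (k :: nat \<Rightarrow> nat)"
    and lim: "\<And>e. 0 < e \<Longrightarrow> \<exists>N. \<forall>n x. n \<ge> N \<and> x \<in> {0..L} \<longrightarrow> norm (u (k n) x - g x) < e"
  proof (rule Arzela_Ascoli[of "{0..L}" u 1])
    show "norm (u n x) \<le> 1" if "x \<in> {0..L}" for n x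
      using normalized_op_range[OF assms nd that, of n] by (simp add: u_def)
    show "\<exists>d>0. \<forall>n y. y \<in> {0..L} \<and> norm (x - y) < d \<longrightarrow> norm (u n x - u n y) < e"
      if "x \<in> {0..L}" "0 < e" for x e
    proof -
      obtain d where "0 < d" "\<forall>\<rho>. nonneg_decreasing \<rho> \<and> 0 < integral {0..L} \<rho> \<longrightarrow>
        (\<forall>x\<in>{0..L}. \<forall>x'\<in>{0..L}. \<bar>x - x'\<bar> < d \<longrightarrow> \<bar>normalized_op p \<rho> x - normalized_op p \<rho> x'\<bar> < e)"
        using normalized_op_equicontinuous[OF assms \<open>0 < e\<close>] by blast
      then show ?thesis using nd pos that by (intro exI[of _ d]) (auto simp: u_def dist_norm)
    qed
  qed auto
  have u_lim: "(\<lambda>n. u (k n) x) \<longlonglongrightarrow> g x" if "x \<in> {0..L}" for x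
    using lim that unfolding LIMSEQ_iff by blast
  have g_nonneg: "0 \<le> g x" if "x \<in> {0..L}" for x
    using normalized_op_range[OF assms nd that]
    by (intro LIMSEQ_le_const[OF u_lim[OF that]]) (auto simp: u_def)
  have g_anti: "antimono_on {0..L} g"
  proof (rule monotone_onI)
    fix x y assume "x \<in> {0..L}" "y \<in> {0..L}" "x \<le> y"
    then show "g y \<le> g x"
      using normalized_op_antimono[OF assms nd]
      by (intro LIMSEQ_le[OF u_lim u_lim]) (auto simp: u_def)
  qed
  have g_nd: "nonneg_decreasing g" using g_nonneg g_anti by (simp add: nonneg_decreasing_def)
  have "0 \<in> {0..L}" "L \<in> {0..L}" using L_pos by auto
  have "g 0 = 1"
    using u_lim[OF \<open>0 \<in> {0..L}\<close>] normalized_op_0[OF nd pos]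
    by (simp add: u_def LIMSEQ_const_iff)
  have "g L = 0"
    using u_lim[OF \<open>L \<in> {0..L}\<close>] by (simp add: u_def LIMSEQ_const_iff normalized_op_L)
  \<comment> \<open>No mass is lost in the limit: a continuous nonnegative function with integral 0
    vanishes, against \<open>g 0 = 1\<close>.\<close>
  have "integral {0..L} g \<noteq> 0"
    using integral_eq_0_iff[OF \<open>continuous_on {0..L} g\<close> L_pos] g_nonneg \<open>g 0 = 1\<close> \<open>0 \<in> {0..L}\<close> by fastforce
  moreover have "0 \<le> integral {0..L} g"
    using g_nonneg by (intro integral_nonneg integrable_profile g_nd)
  ultimately have g0: "0 < kernel_op G L g 0"
    by (intro kernel_op_0_pos g_nd) auto
  define K where "K = 2 * G 0 * L"
  have "0 < K" using G_0_pos L_pos by (simp add: K_def)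
  have A_lim: "(\<lambda>n. kernel_op G L (\<rho> (k n)) x) \<longlonglongrightarrow> kernel_op G L g x" for x
    unfolding LIMSEQ_iff
  proof (intro allI impI)
    fix e :: real assume "0 < e"
    \<comment> \<open>One \<open>\<eta>\<close> for the distance from \<open>\<rho> (k n)\<close> to
      \<open>u (k n)\<close>, one from there to \<open>g\<close>; the Lipschitz constant
      \<open>K\<close> turns the sum into \<open>e / 2\<close>.\<close>
    define \<eta> where "\<eta> = e / (4 * K)"
    have "0 < \<eta>" using \<open>0 < e\<close> \<open>0 < K\<close> by (simp add: \<eta>_def)
    obtain N where N: "\<And>n x. \<lbrakk>n \<ge> N; x \<in> {0..L}\<rbrakk> \<Longrightarrow> \<bar>u (k n) x - g x\<bar> < \<eta>"
      using lim[OF \<open>0 < \<eta>\<close>] by auto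
    obtain M where M: "inverse (real (Suc M)) < \<eta>"
      using reals_Archimedean[OF \<open>0 < \<eta>\<close>] by blast
    show "\<exists>no. \<forall>n\<ge>no. norm (kernel_op G L (\<rho> (k n)) x - kernel_op G L g x) < e"
    proof (intro exI allI impI)
      fix n assume n: "max M N \<le> n"
      have "M \<le> k n" using n seq_suble[OF k, of n] by simp
      then have "inverse (real (Suc (k n))) \<le> inverse (real (Suc M))" by simp
      then have "inverse (real (Suc (k n))) < \<eta>" using M by linarith
      have "\<bar>\<rho> (k n) y - g y\<bar> \<le> 2 * \<eta>" if "y \<in> {0..L}" for y
        using close[OF that, of "k n"] N[of n y] that n \<open>inverse (real (Suc (k n))) < \<eta>\<close>
        unfolding u_def by auto
      then have "\<bar>kernel_op G L (\<rho> (k n)) x - kernel_op G L g x\<bar> \<le> K * (2 * \<eta>)"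
        unfolding K_def by (intro kernel_op_lipschitz nd g_nd)
      also have "\<dots> = e / 2" using \<open>0 < K\<close> by (simp add: \<eta>_def)
      finally show "norm (kernel_op G L (\<rho> (k n)) x - kernel_op G L g x) < e"
        using \<open>0 < e\<close> by simp
    qed
  qed
  show thesis
  proof
    show "g \<in> profile_set L"
      using g_nonneg g_anti \<open>g 0 = 1\<close> \<open>g L = 0\<close> \<open>continuous_on {0..L} g\<close> by (simp add: profile_set_def)
    fix x assume x: "x \<in> {0..L}"
    have "(\<lambda>n. u (k n) x) \<longlonglongrightarrow> normalized_op p g x"
      unfolding u_def normalized_op_def
    \<comment> \<open>The limit of the base can be 0, as at \<open>x = L\<close>;
      \<open>p > 0\<close> and nonnegative ratios cover this case.\<close>
    proof (rule tendsto_powr')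
      show "(\<lambda>n. kernel_op G L (\<rho> (k n)) x / kernel_op G L (\<rho> (k n)) 0) \<longlonglongrightarrow> kernel_op G L g x / kernel_op G L g 0"
        using g0 by (intro tendsto_divide A_lim) auto
    qed (use assms kernel_op_ratio[OF nd x] in auto)
    then show "g x = normalized_op p g x"
      using u_lim[OF x] LIMSEQ_unique by blast
  qed fact
qed

end

section \<open>Application to admissible kernels\<close>

text \<open>The negative derivative is available for \<open>r > 0\<close> only; continuity of
  \<open>G\<close> extends the strict decrease to \<open>r = 0\<close>.\<close>

lemma admissible_kernel_decreasing:
  assumes "admissible_kernel G" "0 < L"
  shows "decreasing_kernel G L"
proof
  have cont: "continuous_on UNIV G" using assms(1) by (simp add: admissible_kernel_def)
  obtain g where g: "\<And>x. G x = g \<bar>x\<bar>"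
    and g': "\<And>r. 0 < r \<Longrightarrow> \<exists>D<0. (g has_real_derivative D) (at r)"
    using assms(1) unfolding admissible_kernel_def by auto
  show "G (- x) = G x" for x by (simp add: g)
  show "0 \<le> G x" for x using assms(1) by (simp add: admissible_kernel_def)
  show "G s < G r" if "0 \<le> r" "r < s" for r s
  proof -
    have "g s < g r"
    proof (rule DERIV_neg_imp_decreasing_open[OF \<open>r < s\<close>])
      show "\<exists>y. (g has_real_derivative y) (at x) \<and> y < 0" if "r < x" "x < s" for x
        using g'[of x] that \<open>0 \<le> r\<close> by auto
      have "continuous_on {r..s} G" using cont continuous_on_subset by blast
      then show "continuous_on {r..s} g"
        by (rule continuous_on_eq) (use \<open>0 \<le> r\<close> in \<open>auto simp: g\<close>)
    qed
    then show ?thesis using that by (simp add: g)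
  qed
qed (use assms in \<open>auto simp: admissible_kernel_def\<close>)

theorem theorem3p7:
  fixes m :: real and G :: "real \<Rightarrow> real"
  assumes "m > 2" and "admissible_kernel G"
  shows "\<forall>L>0. \<exists>\<nu>>0. \<exists>\<rho>\<in>profile_set L.
           \<forall>x\<in>{0..L}. \<nu> * \<rho> x powr (m - 1) = kernel_op G L \<rho> x"
proof (intro allI impI)
  fix L :: real assume "0 < L"
  interpret decreasing_kernel G L
    using assms(2) \<open>0 < L\<close> by (rule admissible_kernel_decreasing)
  obtain \<rho> where \<rho>: "\<rho> \<in> profile_set L" and pos: "0 < kernel_op G L \<rho> 0"
    and eq: "\<And>x. x \<in> {0..L} \<Longrightarrow> \<rho> x = normalized_op (1 / (m - 1)) \<rho> x"
    using solution_exists[of "1 / (m - 1)"] assms(1) by auto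
  have nd: "nonneg_decreasing \<rho>"
    using \<rho> by (simp add: profile_set_def nonneg_decreasing_def)
  \<comment> \<open>The value \<open>kernel_op G L \<rho> 0\<close> serves as \<open>\<nu>\<close>;
    raising the fixed point equation to the power \<open>m - 1\<close> undoes the exponent
    \<open>1 / (m - 1)\<close>.\<close>
  have "kernel_op G L \<rho> 0 * \<rho> x powr (m - 1) = kernel_op G L \<rho> x" if x: "x \<in> {0..L}" for x
  proof -
    have "\<rho> x powr (m - 1) = kernel_op G L \<rho> x / kernel_op G L \<rho> 0"
      using kernel_op_ratio[OF nd x] assms(1)
      by (simp add: eq[OF x] normalized_op_def powr_powr del: abs_divide)
    then show ?thesis using pos by simp
  qed
  then show "\<exists>\<nu>>0. \<exists>\<rho>\<in>profile_set L. \<forall>x\<in>{0..L}. \<nu> * \<rho> x powr (m - 1) = kernel_op G L \<rho> x"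
    using pos \<rho> by blast
qed

end
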